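(* Let $(S,T,\sigma)$ be a normal subcrossed module of a crossed module $(A,B,\alpha)$ in $\mathsf{C}$. Let $(N,s_N,t_N)$ and $(G,s_G,t_G)$ be the cat$^1$-groups with operations corresponding to $(S,T,\sigma)$ and $(A,B,\alpha)$ respectively. Then $N$ is an ideal of $G$.
   Context: Groups with operations. $\mathsf{C}$ is a fixed category of groups with operations: its objects are the algebras with a set $\Omega$ of operations satisfying a set $\mathsf{E}$ of identities, where $\mathsf{E}$ includes the group laws and, with $\Omega_i$ the set of $i$-ary operations: (a) $\Omega=\Omega_0\cup\Omega_1\cup\Omega_2$; (b) the group operations $0,-,+$ (written additively, $+$ not necessarily commutative) belong to $\Omega_0,\Omega_1,\Omega_2$ respectively, $\Omega_0=\{0\}$, and with $\Omega_1'=\Omega_1\setminus\{-\}$, $\Omega_2'=\Omega_2\setminus\{+\}$, if $\star\in\Omega_2'$ then the operation $a\star^{\circ}b=b\star a$ is also in $\Omega_2'$; (c) for each $\star\in\Omega_2'$, $\mathsf{E}$ includes $a\star(b+c)=a\star b+a\star c$; (d) for $\omega\in\Omega_1'$, $\star\in\Omega_2'$, $\mathsf{E}$ includes $\omega(a+b)=\omega(a)+\omega(b)$ and $\omega(a)\star b=\omega(a\star b)$. Morphisms are group homomorphisms preserving all operations in $\Omega_1'$ and $\Omega_2'$. A subobject is a subset containing $0$ and closed under all operations. An ideal $N$ of $A$ is a subobject with $(N,+)$ normal in $(A,+)$ and $a\star n\in N$ for all $a\in A$, $n\in N$, $\star\in\Omega_2'$. Derived actions. Derived actions of $B$ on $A$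 (objects of $\mathsf{C}$) are the maps $b\cdot a=s(b)+a-s(b)$ and $b\star a=s(b)\star a$ ($\star\in\Omega_2'$) obtained from a split extension $0\to A\to E\xrightarrow{p}B\to 0$ in $\mathsf{C}$ ($p$ surjective, $A=\ker p$, $s\colon B\to E$ a morphism with $ps=\mathrm{id}_B$). One writes $a\star b:=b\star^{\circ}a$. The semidirect product $A\rtimes B$ is the set $A\times B$ with $(a',b')+(a,b)=(a'+b'\cdot a,\,b'+b)$, $(a',b')\star(a,b)=(a'\star a+a'\star b+b'\star a,\,b'\star b)$, $\omega(a,b)=(\omega(a),\omega(b))$ for $\omega\in\Omega_1'$; it is an object of $\mathsf{C}$. Crossed modules. A crossed module $(A,B,\alpha)$ in $\mathsf{C}$ consists of objects $A,B$, derived actions of $B$ on $A$, and a morphism $\alpha\colon A\to B$ such that for all $b\in B$, $a,a'\in A$, $\star\in\Omega_2'$: $\alpha(b\cdot a)=b+\alpha(a)-b$; $\alpha(a)\cdot a'=a+a'-a$; $\alpha(a)\star a'=a\star a'$; $\alpha(b\star a)=b\star\alpha(a)$ and $\alpha(a\star b)=\alpha(a)\star b$. A crossed module $(S,T,\sigma)$ is a subcrossed module of $(A,B,\alpha)$ if $S\subseteq A$ and $T\subseteq B$ are subobjects, $\sigma$ is the restriction of $\alpha$, and the actions of $T$ on $S$ are induced by those of $B$ on $A$. It is normal if: $T$ is an ideal of $B$; $b\cdot s\in S$, $(t\cdot a)-a\in S$, $b\star s\in S$, $t\star a\in S$ for all $b\in B,s\in S,t\in T,a\in A$, $\star\in\Omega_2'$.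 Cat$^1$-groups with operations. A cat$^1$-group with operations is a triple $(G,s,t)$ with $G$ an object of $\mathsf{C}$ and $s,t$ endomorphisms of $G$ in $\mathsf{C}$ such that $st=t$, $ts=s$, elements of $\ker s$ and $\ker t$ commute under $+$, and $x\star y=0$ for $x\in\ker s$, $y\in\ker t$, $\star\in\Omega_2'$. The cat$^1$-group with operations corresponding to a crossed module $(A,B,\alpha)$ is $(A\rtimes B,s,t)$ with $s(a,b)=(0,b)$ and $t(a,b)=(0,\alpha(a)+b)$. *)

theory Defs
  imports "HOL-Algebra.Coset"
begin

section \<open>Groups with operations\<close>

text \<open>
  The group structure is that of \<open>HOL-Algebra\<close>: the additive notation \<open>a + b\<close>, \<open>0\<close>, \<open>-a\<close> of the
  literature is written \<open>a \<otimes> b\<close>, \<open>\<one>\<close>, \<open>inv a\<close> (no commutativity is assumed). The additional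
  operations are indexed by symbols of types \<open>'u\<close> and \<open>'w\<close>, of which only those in \<open>unary\<close>
  (\<open>\<Omega>\<^sub>1'\<close>) and \<open>binary\<close> (\<open>\<Omega>\<^sub>2'\<close>) are relevant; both sets may be empty.
\<close>

datatype ('u, 'w) op_term =
    Var nat
  | Zero
  | Minus "('u, 'w) op_term"
  | Plus "('u, 'w) op_term" "('u, 'w) op_term"
  | UnOp 'u "('u, 'w) op_term"
  | BinOp 'w "('u, 'w) op_term" "('u, 'w) op_term"

record ('u, 'w) op_theory =
  unary :: "'u set"
  binary :: "'w set"
  opp :: "'w \<Rightarrow> 'w"
  identities :: "(('u, 'w) op_term \<times> ('u, 'w) op_term) set"

record ('a, 'u, 'w) op_group = "'a monoid" +
  unop :: "'u \<Rightarrow> 'a \<Rightarrow> 'a"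
  binop :: "'w \<Rightarrow> 'a \<Rightarrow> 'a \<Rightarrow> 'a"

fun wf_op_term :: "('u, 'w) op_theory \<Rightarrow> ('u, 'w) op_term \<Rightarrow> bool" where
  "wf_op_term C (Var n) \<longleftrightarrow> True"
| "wf_op_term C Zero \<longleftrightarrow> True"
| "wf_op_term C (Minus x) \<longleftrightarrow> wf_op_term C x"
| "wf_op_term C (Plus x y) \<longleftrightarrow> wf_op_term C x \<and> wf_op_term C y"
| "wf_op_term C (UnOp \<omega> x) \<longleftrightarrow> \<omega> \<in> unary C \<and> wf_op_term C x"
| "wf_op_term C (BinOp w x y) \<longleftrightarrow> w \<in> binary C \<and> wf_op_term C x \<and> wf_op_term C y"

fun eval_op_term :: "('a, 'u, 'w) op_group \<Rightarrow> (nat \<Rightarrow> 'a) \<Rightarrow> ('u, 'w) op_term \<Rightarrow> 'a" where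
  "eval_op_term A v (Var n) = v n"
| "eval_op_term A v Zero = \<one>\<^bsub>A\<^esub>"
| "eval_op_term A v (Minus x) = inv\<^bsub>A\<^esub> (eval_op_term A v x)"
| "eval_op_term A v (Plus x y) = eval_op_term A v x \<otimes>\<^bsub>A\<^esub> eval_op_term A v y"
| "eval_op_term A v (UnOp \<omega> x) = unop A \<omega> (eval_op_term A v x)"
| "eval_op_term A v (BinOp w x y) = binop A w (eval_op_term A v x) (eval_op_term A v y)"

text \<open>
  The data \<open>(\<Omega>, E)\<close> fixing a category of groups with operations. The set \<open>identities C\<close> is otherwise
  arbitrary. It need not list the group laws, which are imposed on objects by \<^const>\<open>group\<close>.
\<close>

definition groups_with_operations :: "('u, 'w) op_theory \<Rightarrow> bool" where
  "groups_with_operations C \<longleftrightarrow>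
     (\<forall>(l, r) \<in> identities C. wf_op_term C l \<and> wf_op_term C r) \<and>
     (\<forall>w \<in> binary C. opp C w \<in> binary C \<and>
        (BinOp (opp C w) (Var 0) (Var 1), BinOp w (Var 1) (Var 0)) \<in> identities C \<and>
        (BinOp w (Var 0) (Plus (Var 1) (Var 2)),
         Plus (BinOp w (Var 0) (Var 1)) (BinOp w (Var 0) (Var 2))) \<in> identities C) \<and>
     (\<forall>\<omega> \<in> unary C.
        (UnOp \<omega> (Plus (Var 0) (Var 1)), Plus (UnOp \<omega> (Var 0)) (UnOp \<omega> (Var 1))) \<in> identities C \<and>
        (\<forall>w \<in> binary C.
           (BinOp w (UnOp \<omega> (Var 0)) (Var 1), UnOp \<omega> (BinOp w (Var 0) (Var 1))) \<in> identities C))"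

definition object :: "('u, 'w) op_theory \<Rightarrow> ('a, 'u, 'w) op_group \<Rightarrow> bool" where
  "object C A \<longleftrightarrow>
     group A \<and>
     (\<forall>\<omega> \<in> unary C. \<forall>a \<in> carrier A. unop A \<omega> a \<in> carrier A) \<and>
     (\<forall>w \<in> binary C. \<forall>a \<in> carrier A. \<forall>b \<in> carrier A. binop A w a b \<in> carrier A) \<and>
     (\<forall>(l, r) \<in> identities C. \<forall>v. (\<forall>n. v n \<in> carrier A) \<longrightarrow>
        eval_op_term A v l = eval_op_term A v r)"

definition morphism ::
  "('u, 'w) op_theory \<Rightarrow> ('a, 'u, 'w) op_group \<Rightarrow> ('b, 'u, 'w) op_group \<Rightarrow> ('a \<Rightarrow> 'b) \<Rightarrow> bool" where
  "morphism C A B f \<longleftrightarrow>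
     f \<in> hom A B \<and>
     (\<forall>\<omega> \<in> unary C. \<forall>a \<in> carrier A. f (unop A \<omega> a) = unop B \<omega> (f a)) \<and>
     (\<forall>w \<in> binary C. \<forall>a \<in> carrier A. \<forall>a' \<in> carrier A. f (binop A w a a') = binop B w (f a) (f a'))"

text \<open>
  Subobjects carry their own operations, which have to agree with the ambient ones on the carrier.
\<close>

definition subobject ::
  "('u, 'w) op_theory \<Rightarrow> ('a, 'u, 'w) op_group \<Rightarrow> ('a, 'u, 'w) op_group \<Rightarrow> bool" where
  "subobject C M A \<longleftrightarrow>
     object C A \<and>
     subgroup (carrier M) A \<and>
     (\<forall>\<omega> \<in> unary C. \<forall>a \<in> carrier M. unop A \<omega> a \<in> carrier M) \<and>
     (\<forall>w \<in> binary C. \<forall>a \<in> carrier M. \<forall>b \<in> carrier M. binop A w a b \<in> carrier M) \<and>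
     \<one>\<^bsub>M\<^esub> = \<one>\<^bsub>A\<^esub> \<and>
     (\<forall>a \<in> carrier M. \<forall>b \<in> carrier M. a \<otimes>\<^bsub>M\<^esub> b = a \<otimes>\<^bsub>A\<^esub> b) \<and>
     (\<forall>\<omega> \<in> unary C. \<forall>a \<in> carrier M. unop M \<omega> a = unop A \<omega> a) \<and>
     (\<forall>w \<in> binary C. \<forall>a \<in> carrier M. \<forall>b \<in> carrier M. binop M w a b = binop A w a b)"

definition op_ideal ::
  "('u, 'w) op_theory \<Rightarrow> ('a, 'u, 'w) op_group \<Rightarrow> ('a, 'u, 'w) op_group \<Rightarrow> bool" where
  "op_ideal C N A \<longleftrightarrow>
     subobject C N A \<and>
     carrier N \<lhd> A \<and>
     (\<forall>w \<in> binary C. \<forall>a \<in> carrier A. \<forall>n \<in> carrier N. binop A w a n \<in> carrier N)"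

section \<open>Derived actions and semidirect products\<close>

definition split_extension ::
  "('u, 'w) op_theory \<Rightarrow> ('a, 'u, 'w) op_group \<Rightarrow> ('e, 'u, 'w) op_group \<Rightarrow> ('b, 'u, 'w) op_group \<Rightarrow>
   ('a \<Rightarrow> 'e) \<Rightarrow> ('e \<Rightarrow> 'b) \<Rightarrow> ('b \<Rightarrow> 'e) \<Rightarrow> bool" where
  "split_extension C A E B i p s \<longleftrightarrow>
     object C A \<and> object C E \<and> object C B \<and>
     morphism C A E i \<and> inj_on i (carrier A) \<and> i ` carrier A = kernel E B p \<and>
     morphism C E B p \<and> p ` carrier E = carrier B \<and>
     morphism C B E s \<and> (\<forall>b \<in> carrier B. p (s b) = b)"

text \<open>
  \<open>dot b a\<close> is the action \<open>b \<cdot> a\<close> and \<open>star w b a\<close> is the action \<open>b \<star> a\<close> for the operation symbol \<open>w\<close>.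
\<close>

definition induced_actions ::
  "('u, 'w) op_theory \<Rightarrow> ('a, 'u, 'w) op_group \<Rightarrow> ('e, 'u, 'w) op_group \<Rightarrow> ('b, 'u, 'w) op_group \<Rightarrow>
   ('a \<Rightarrow> 'e) \<Rightarrow> ('b \<Rightarrow> 'e) \<Rightarrow> ('b \<Rightarrow> 'a \<Rightarrow> 'a) \<Rightarrow> ('w \<Rightarrow> 'b \<Rightarrow> 'a \<Rightarrow> 'a) \<Rightarrow> bool" where
  "induced_actions C A E B i s dot star \<longleftrightarrow>
     (\<forall>b \<in> carrier B. \<forall>a \<in> carrier A.
        dot b a \<in> carrier A \<and> i (dot b a) = s b \<otimes>\<^bsub>E\<^esub> i a \<otimes>\<^bsub>E\<^esub> inv\<^bsub>E\<^esub> (s b) \<and>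
        (\<forall>w \<in> binary C. star w b a \<in> carrier A \<and> i (star w b a) = binop E w (s b) (i a)))"

text \<open>
  The existential ranges over extensions \<open>E\<close> whose elements have type \<open>'a \<times> 'b\<close>. This is no
  restriction, see \<open>derived_actionsI\<close> below: an extension of any type \<open>'e\<close> induces derived actions.
\<close>

definition derived_actions ::
  "('u, 'w) op_theory \<Rightarrow> ('a, 'u, 'w) op_group \<Rightarrow> ('b, 'u, 'w) op_group \<Rightarrow>
   ('b \<Rightarrow> 'a \<Rightarrow> 'a) \<Rightarrow> ('w \<Rightarrow> 'b \<Rightarrow> 'a \<Rightarrow> 'a) \<Rightarrow> bool" where
  "derived_actions C A B dot star \<longleftrightarrow>
     (\<exists>(E :: ('a \<times> 'b, 'u, 'w) op_group) i p s.
        split_extension C A E B i p s \<and> induced_actions C A E B i s dot star)"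

text \<open>In \<open>binop\<close>, the middle summand \<open>star (opp C w) b a'\<close> is \<open>a' \<star> b := b \<star>\<^sup>o a'\<close>.\<close>

definition semidirect ::
  "('u, 'w) op_theory \<Rightarrow> ('a, 'u, 'w) op_group \<Rightarrow> ('b, 'u, 'w) op_group \<Rightarrow>
   ('b \<Rightarrow> 'a \<Rightarrow> 'a) \<Rightarrow> ('w \<Rightarrow> 'b \<Rightarrow> 'a \<Rightarrow> 'a) \<Rightarrow> ('a \<times> 'b, 'u, 'w) op_group" where
  "semidirect C A B dot star =
     \<lparr>carrier = carrier A \<times> carrier B,
      mult = (\<lambda>(a', b') (a, b). (a' \<otimes>\<^bsub>A\<^esub> dot b' a, b' \<otimes>\<^bsub>B\<^esub> b)),
      one = (\<one>\<^bsub>A\<^esub>, \<one>\<^bsub>B\<^esub>),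
      unop = (\<lambda>\<omega> (a, b). (unop A \<omega> a, unop B \<omega> b)),
      binop = (\<lambda>w (a', b') (a, b).
        (binop A w a' a \<otimes>\<^bsub>A\<^esub> star (opp C w) b a' \<otimes>\<^bsub>A\<^esub> star w b' a, binop B w b' b))\<rparr>"

section \<open>Crossed modules\<close>

record ('a, 'b, 'u, 'w) crossed =
  src :: "('a, 'u, 'w) op_group"
  tgt :: "('b, 'u, 'w) op_group"
  bdry :: "'a \<Rightarrow> 'b"
  act_dot :: "'b \<Rightarrow> 'a \<Rightarrow> 'a"
  act_star :: "'w \<Rightarrow> 'b \<Rightarrow> 'a \<Rightarrow> 'a"

definition crossed_module :: "('u, 'w) op_theory \<Rightarrow> ('a, 'b, 'u, 'w) crossed \<Rightarrow> bool" where
  "crossed_module C X \<longleftrightarrow>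
     (let A = src X; B = tgt X; \<alpha> = bdry X in
        object C A \<and> object C B \<and>
        derived_actions C A B (act_dot X) (act_star X) \<and>
        morphism C A B \<alpha> \<and>
        (\<forall>b \<in> carrier B. \<forall>a \<in> carrier A. \<alpha> (act_dot X b a) = b \<otimes>\<^bsub>B\<^esub> \<alpha> a \<otimes>\<^bsub>B\<^esub> inv\<^bsub>B\<^esub> b) \<and>
        (\<forall>a \<in> carrier A. \<forall>a' \<in> carrier A. act_dot X (\<alpha> a) a' = a \<otimes>\<^bsub>A\<^esub> a' \<otimes>\<^bsub>A\<^esub> inv\<^bsub>A\<^esub> a) \<and>
        (\<forall>w \<in> binary C. \<forall>a \<in> carrier A. \<forall>a' \<in> carrier A.
           act_star X w (\<alpha> a) a' = binop A w a a') \<and>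
        (\<forall>w \<in> binary C. \<forall>b \<in> carrier B. \<forall>a \<in> carrier A.
           \<alpha> (act_star X w b a) = binop B w b (\<alpha> a) \<and>
           \<alpha> (act_star X (opp C w) b a) = binop B w (\<alpha> a) b))"

definition subcrossed_module ::
  "('u, 'w) op_theory \<Rightarrow> ('a, 'b, 'u, 'w) crossed \<Rightarrow> ('a, 'b, 'u, 'w) crossed \<Rightarrow> bool" where
  "subcrossed_module C Y X \<longleftrightarrow>
     crossed_module C Y \<and> crossed_module C X \<and>
     subobject C (src Y) (src X) \<and> subobject C (tgt Y) (tgt X) \<and>
     (\<forall>s \<in> carrier (src Y). bdry Y s = bdry X s) \<and>
     (\<forall>t \<in> carrier (tgt Y). \<forall>s \<in> carrier (src Y). act_dot Y t s = act_dot X t s) \<and>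
     (\<forall>w \<in> binary C. \<forall>t \<in> carrier (tgt Y). \<forall>s \<in> carrier (src Y). act_star Y w t s = act_star X w t s)"

definition normal_subcrossed_module ::
  "('u, 'w) op_theory \<Rightarrow> ('a, 'b, 'u, 'w) crossed \<Rightarrow> ('a, 'b, 'u, 'w) crossed \<Rightarrow> bool" where
  "normal_subcrossed_module C Y X \<longleftrightarrow>
     (let A = src X; B = tgt X; S = src Y; T = tgt Y in
        subcrossed_module C Y X \<and>
        op_ideal C T B \<and>
        (\<forall>b \<in> carrier B. \<forall>s \<in> carrier S. act_dot X b s \<in> carrier S) \<and>
        (\<forall>t \<in> carrier T. \<forall>a \<in> carrier A. act_dot X t a \<otimes>\<^bsub>A\<^esub> inv\<^bsub>A\<^esub> a \<in> carrier S) \<and>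
        (\<forall>w \<in> binary C. \<forall>b \<in> carrier B. \<forall>s \<in> carrier S. act_star X w b s \<in> carrier S) \<and>
        (\<forall>w \<in> binary C. \<forall>t \<in> carrier T. \<forall>a \<in> carrier A. act_star X w t a \<in> carrier S))"

section \<open>Cat1-groups with operations\<close>

definition cat1_group ::
  "('u, 'w) op_theory \<Rightarrow> ('a, 'u, 'w) op_group \<times> ('a \<Rightarrow> 'a) \<times> ('a \<Rightarrow> 'a) \<Rightarrow> bool" where
  "cat1_group C = (\<lambda>(G, s, t).
     object C G \<and> morphism C G G s \<and> morphism C G G t \<and>
     (\<forall>x \<in> carrier G. s (t x) = t x \<and> t (s x) = s x) \<and>
     (\<forall>x \<in> kernel G G s. \<forall>y \<in> kernel G G t.
        x \<otimes>\<^bsub>G\<^esub> y = y \<otimes>\<^bsub>G\<^esub> x \<and> (\<forall>w \<in> binary C. binop G w x y = \<one>\<^bsub>G\<^esub>)))"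

definition cat1_of_crossed ::
  "('u, 'w) op_theory \<Rightarrow> ('a, 'b, 'u, 'w) crossed \<Rightarrow>
   ('a \<times> 'b, 'u, 'w) op_group \<times> ('a \<times> 'b \<Rightarrow> 'a \<times> 'b) \<times> ('a \<times> 'b \<Rightarrow> 'a \<times> 'b)" where
  "cat1_of_crossed C X =
     (semidirect C (src X) (tgt X) (act_dot X) (act_star X),
      (\<lambda>(a, b). (\<one>\<^bsub>src X\<^esub>, b)),
      (\<lambda>(a, b). (\<one>\<^bsub>src X\<^esub>, bdry X a \<otimes>\<^bsub>tgt X\<^esub> b)))"


section \<open>Derived actions from extensions of arbitrary type\<close>

lemma object_identity:
  assumes "object C A" "(l, r) \<in> identities C" "\<forall>n. v n \<in> carrier A"
  shows "eval_op_term A v l = eval_op_term A v r"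
  using assms unfolding object_def by fast

lemma object_binop_right_distrib:
  assumes C: "groups_with_operations C" and A: "object C A" and w: "w \<in> binary C"
    and abc: "a \<in> carrier A" "b \<in> carrier A" "c \<in> carrier A"
  shows "binop A w a (b \<otimes>\<^bsub>A\<^esub> c) = binop A w a b \<otimes>\<^bsub>A\<^esub> binop A w a c"
proof -
  let ?v = "\<lambda>n::nat. if n = 0 then a else if n = 1 then b else c"
  have m: "(BinOp w (Var 0) (Plus (Var 1) (Var 2)),
      Plus (BinOp w (Var 0) (Var 1)) (BinOp w (Var 0) (Var 2))) \<in> identities C"
    using C w unfolding groups_with_operations_def by blast
  have "\<forall>n. ?v n \<in> carrier A" using abc by simp
  from object_identity[OF A m this] have "eval_op_term A ?v (BinOp w (Var 0) (Plus (Var 1) (Var 2))) =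
      eval_op_term A ?v (Plus (BinOp w (Var 0) (Var 1)) (BinOp w (Var 0) (Var 2)))" .
  then show ?thesis by simp
qed

lemma object_binop_opp:
  assumes C: "groups_with_operations C" and A: "object C A" and w: "w \<in> binary C"
    and ab: "a \<in> carrier A" "b \<in> carrier A"
  shows "binop A (opp C w) a b = binop A w b a"
proof -
  let ?v = "\<lambda>n::nat. if n = 0 then a else b"
  have m: "(BinOp (opp C w) (Var 0) (Var 1), BinOp w (Var 1) (Var 0)) \<in> identities C"
    using C w unfolding groups_with_operations_def by blast
  have "\<forall>n. ?v n \<in> carrier A" using ab by simp
  from object_identity[OF A m this] have "eval_op_term A ?v (BinOp (opp C w) (Var 0) (Var 1)) =
      eval_op_term A ?v (BinOp w (Var 1) (Var 0))" .
  then show ?thesis by simp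
qed

lemma object_binop_left_distrib:
  assumes C: "groups_with_operations C" and A: "object C A" and w: "w \<in> binary C"
    and abc: "a \<in> carrier A" "b \<in> carrier A" "c \<in> carrier A"
  shows "binop A w (b \<otimes>\<^bsub>A\<^esub> c) a = binop A w b a \<otimes>\<^bsub>A\<^esub> binop A w c a"
proof -
  interpret group A using A by (simp add: object_def)
  have o: "opp C w \<in> binary C" using C w unfolding groups_with_operations_def by blast
  have "binop A w (b \<otimes>\<^bsub>A\<^esub> c) a = binop A (opp C w) a (b \<otimes>\<^bsub>A\<^esub> c)"
    using object_binop_opp[OF C A w] abc by simp
  also have "\<dots> = binop A (opp C w) a b \<otimes>\<^bsub>A\<^esub> binop A (opp C w) a c"
    by (rule object_binop_right_distrib[OF C A o abc])
  finally show ?thesis using object_binop_opp[OF C A w] abc by simp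
qed

lemma object_unop_distrib:
  assumes C: "groups_with_operations C" and A: "object C A" and \<omega>: "\<omega> \<in> unary C"
    and ab: "a \<in> carrier A" "b \<in> carrier A"
  shows "unop A \<omega> (a \<otimes>\<^bsub>A\<^esub> b) = unop A \<omega> a \<otimes>\<^bsub>A\<^esub> unop A \<omega> b"
proof -
  let ?v = "\<lambda>n::nat. if n = 0 then a else b"
  have m: "(UnOp \<omega> (Plus (Var 0) (Var 1)), Plus (UnOp \<omega> (Var 0)) (UnOp \<omega> (Var 1))) \<in> identities C"
    using C \<omega> unfolding groups_with_operations_def by blast
  have "\<forall>n. ?v n \<in> carrier A" using ab by simp
  from object_identity[OF A m this] have "eval_op_term A ?v (UnOp \<omega> (Plus (Var 0) (Var 1))) =
      eval_op_term A ?v (Plus (UnOp \<omega> (Var 0)) (UnOp \<omega> (Var 1)))" .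
  then show ?thesis by simp
qed

lemma object_transport:
  assumes wf: "\<forall>(l, r) \<in> identities C. wf_op_term C l \<and> wf_op_term C r"
    and E: "object C E"
    and bij: "bij_betw f (carrier G) (carrier E)"
    and one: "\<one>\<^bsub>G\<^esub> \<in> carrier G"
    and mult: "\<And>x y. x \<in> carrier G \<Longrightarrow> y \<in> carrier G \<Longrightarrow>
       x \<otimes>\<^bsub>G\<^esub> y \<in> carrier G \<and> f (x \<otimes>\<^bsub>G\<^esub> y) = f x \<otimes>\<^bsub>E\<^esub> f y"
    and un: "\<And>\<omega> x. \<omega> \<in> unary C \<Longrightarrow> x \<in> carrier G \<Longrightarrow>
       unop G \<omega> x \<in> carrier G \<and> f (unop G \<omega> x) = unop E \<omega> (f x)"
    and bin: "\<And>w x y. w \<in> binary C \<Longrightarrow> x \<in> carrier G \<Longrightarrow> y \<in> carrier G \<Longrightarrow>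
       binop G w x y \<in> carrier G \<and> f (binop G w x y) = binop E w (f x) (f y)"
    and fone: "f \<one>\<^bsub>G\<^esub> = \<one>\<^bsub>E\<^esub>"
  shows "object C G"
proof -
  interpret E: group E using E by (simp add: object_def)
  have fc: "f x \<in> carrier E" if "x \<in> carrier G" for x using bij that by (auto simp: bij_betw_def)
  have inj: "x = y" if "x \<in> carrier G" "y \<in> carrier G" "f x = f y" for x y
    using bij that by (auto simp: bij_betw_def inj_on_def)
  have G: "group G"
  proof (rule groupI)
    fix x y z assume a: "x \<in> carrier G" "y \<in> carrier G" "z \<in> carrier G"
    show "x \<otimes>\<^bsub>G\<^esub> y \<otimes>\<^bsub>G\<^esub> z = x \<otimes>\<^bsub>G\<^esub> (y \<otimes>\<^bsub>G\<^esub> z)"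
      by (rule inj) (use a mult fc in \<open>auto simp: E.m_assoc\<close>)
  next
    fix x assume a: "x \<in> carrier G"
    show "\<one>\<^bsub>G\<^esub> \<otimes>\<^bsub>G\<^esub> x = x" by (rule inj) (use a mult fc one fone in auto)
    have "inv\<^bsub>E\<^esub> (f x) \<in> f ` carrier G" using bij fc[OF a] by (simp add: bij_betw_def)
    then obtain y where y: "y \<in> carrier G" "f y = inv\<^bsub>E\<^esub> (f x)" by force
    have "y \<otimes>\<^bsub>G\<^esub> x = \<one>\<^bsub>G\<^esub>" by (rule inj) (use a y mult fc one fone in auto)
    with y show "\<exists>y\<in>carrier G. y \<otimes>\<^bsub>G\<^esub> x = \<one>\<^bsub>G\<^esub>" by blast
  qed (use mult one in auto)
  interpret G: group G by (rule G)
  have hom: "f \<in> hom G E" using mult fc by (auto simp: hom_def)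
  interpret group_hom G E f by unfold_locales (rule hom)
  have ev: "eval_op_term G v x \<in> carrier G \<and> f (eval_op_term G v x) = eval_op_term E (f \<circ> v) x"
    if "wf_op_term C x" "\<forall>n. v n \<in> carrier G" for v x
    using that by (induction x) (auto simp: mult un bin fone)
  have "eval_op_term G v l = eval_op_term G v r"
    if lr: "(l, r) \<in> identities C" and v: "\<forall>n. v n \<in> carrier G" for l r v
  proof -
    have w: "wf_op_term C l" "wf_op_term C r" using wf lr by auto
    have "\<forall>n. (f \<circ> v) n \<in> carrier E" using v fc by simp
    then have "eval_op_term E (f \<circ> v) l = eval_op_term E (f \<circ> v) r"
      by (rule object_identity[OF E lr])
    with ev[OF w(1) v] ev[OF w(2) v] show ?thesis by (auto intro: inj)
  qed
  then show ?thesis using G un bin unfolding object_def by blast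
qed

lemma split_extension_semidirect:
  fixes E :: "('e, 'u, 'w) op_group"
  assumes C: "groups_with_operations C"
    and se: "split_extension C A E B i p s"
    and ia: "induced_actions C A E B i s dot star"
  defines "G \<equiv> semidirect C A B dot star" and "f \<equiv> \<lambda>(a, b). i a \<otimes>\<^bsub>E\<^esub> s b"
  shows "object C G" "bij_betw f (carrier G) (carrier E)" "morphism C G E f"
proof -
  have A: "object C A" and E: "object C E" and B: "object C B"
    and mi: "morphism C A E i" and mp: "morphism C E B p" and ms: "morphism C B E s"
    and inj_i: "inj_on i (carrier A)" and im_i: "i ` carrier A = kernel E B p"
    and ps: "\<And>b. b \<in> carrier B \<Longrightarrow> p (s b) = b"
    using se by (auto simp: split_extension_def)
  interpret A: group A using A by (simp add: object_def)
  interpret B: group B using B by (simp add: object_def)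
  interpret E: group E using E by (simp add: object_def)
  interpret i: group_hom A E i by unfold_locales (use mi in \<open>simp add: morphism_def\<close>)
  interpret p: group_hom E B p by unfold_locales (use mp in \<open>simp add: morphism_def\<close>)
  interpret s: group_hom B E s by unfold_locales (use ms in \<open>simp add: morphism_def\<close>)
  have dot: "dot b a \<in> carrier A \<and> i (dot b a) = s b \<otimes>\<^bsub>E\<^esub> i a \<otimes>\<^bsub>E\<^esub> inv\<^bsub>E\<^esub> s b"
    if "a \<in> carrier A" "b \<in> carrier B" for a b
    using ia that by (simp add: induced_actions_def)
  have star: "star w b a \<in> carrier A \<and> i (star w b a) = binop E w (s b) (i a)"
    if "w \<in> binary C" "a \<in> carrier A" "b \<in> carrier B" for w a b
    using ia that by (simp add: induced_actions_def)
  have oppc: "opp C w \<in> binary C" if "w \<in> binary C" for w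
    using C that unfolding groups_with_operations_def by blast
  have pi: "p (i a) = \<one>\<^bsub>B\<^esub>" if "a \<in> carrier A" for a
    using im_i that by (auto simp: kernel_def)
  have cG: "carrier G = carrier A \<times> carrier B" by (simp add: G_def semidirect_def)
  have pf: "p (f (a, b)) = b" if "a \<in> carrier A" "b \<in> carrier B" for a b
    using that by (simp add: f_def pi ps)
  show bij: "bij_betw f (carrier G) (carrier E)"
  proof (rule bij_betw_imageI)
    show "inj_on f (carrier G)"
    proof (rule inj_onI)
      fix x y assume x: "x \<in> carrier G" and y: "y \<in> carrier G" and eq: "f x = f y"
      obtain a b where [simp]: "x = (a, b)" by force
      obtain a' b' where [simp]: "y = (a', b')" by force
      have m: "a \<in> carrier A" "b \<in> carrier B" "a' \<in> carrier A" "b' \<in> carrier B"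
        using x y by (auto simp: cG)
      have bb: "b = b'" using pf[OF m(1,2)] pf[OF m(3,4)] eq by simp
      then have "i a = i a'" using eq m by (simp add: f_def)
      then show "x = y" using bb inj_i m by (simp add: inj_on_def)
    qed
    show "f ` carrier G = carrier E"
    proof
      show "f ` carrier G \<subseteq> carrier E" by (auto simp: cG f_def)
      show "carrier E \<subseteq> f ` carrier G"
      proof
        fix e assume e: "e \<in> carrier E"
        let ?k = "e \<otimes>\<^bsub>E\<^esub> inv\<^bsub>E\<^esub> s (p e)"
        have "?k \<in> kernel E B p" using e by (simp add: kernel_def ps)
        then obtain a where a: "a \<in> carrier A" "i a = ?k" using im_i by (metis imageE)
        have "f (a, p e) = e" using a e by (simp add: f_def E.m_assoc)
        moreover have "(a, p e) \<in> carrier G" using a e by (simp add: cG)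
        ultimately show "e \<in> f ` carrier G" by (metis image_eqI)
      qed
    qed
  qed
  have uncl: "unop A \<omega> a \<in> carrier A" "i (unop A \<omega> a) = unop E \<omega> (i a)"
      if "\<omega> \<in> unary C" "a \<in> carrier A" for \<omega> a
    using A mi that by (auto simp: object_def morphism_def)
  have unclB: "unop B \<omega> a \<in> carrier B" "s (unop B \<omega> a) = unop E \<omega> (s a)"
      if "\<omega> \<in> unary C" "a \<in> carrier B" for \<omega> a
    using B ms that by (auto simp: object_def morphism_def)
  have bincl: "binop A w a a' \<in> carrier A" "i (binop A w a a') = binop E w (i a) (i a')"
      if "w \<in> binary C" "a \<in> carrier A" "a' \<in> carrier A" for w a a'
    using A mi that by (auto simp: object_def morphism_def)
  have binclB: "binop B w a a' \<in> carrier B" "s (binop B w a a') = binop E w (s a) (s a')"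
      if "w \<in> binary C" "a \<in> carrier B" "a' \<in> carrier B" for w a a'
    using B ms that by (auto simp: object_def morphism_def)
  have binclE: "binop E w a a' \<in> carrier E"
      if "w \<in> binary C" "a \<in> carrier E" "a' \<in> carrier E" for w a a'
    using E that by (auto simp: object_def)
  have mult: "x \<otimes>\<^bsub>G\<^esub> y \<in> carrier G \<and> f (x \<otimes>\<^bsub>G\<^esub> y) = f x \<otimes>\<^bsub>E\<^esub> f y"
    if "x \<in> carrier G" "y \<in> carrier G" for x y
  proof -
    obtain a b where [simp]: "x = (a, b)" by force
    obtain a' b' where [simp]: "y = (a', b')" by force
    have m: "a \<in> carrier A" "b \<in> carrier B" "a' \<in> carrier A" "b' \<in> carrier B"
      using that by (auto simp: cG)
    have "inv\<^bsub>E\<^esub> s b \<otimes>\<^bsub>E\<^esub> (s b \<otimes>\<^bsub>E\<^esub> s b') = s b'" using m by (simp flip: E.m_assoc)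
    then show ?thesis using m dot[OF m(3,2)]
      by (simp add: G_def semidirect_def f_def E.m_assoc)
  qed
  have un: "unop G \<omega> x \<in> carrier G \<and> f (unop G \<omega> x) = unop E \<omega> (f x)"
    if "\<omega> \<in> unary C" "x \<in> carrier G" for \<omega> x
    using that object_unop_distrib[OF C E, of \<omega>]
    by (auto simp: G_def semidirect_def f_def uncl unclB)
  have bin: "binop G w x y \<in> carrier G \<and> f (binop G w x y) = binop E w (f x) (f y)"
    if w: "w \<in> binary C" and xy: "x \<in> carrier G" "y \<in> carrier G" for w x y
  proof -
    obtain a b where [simp]: "x = (a, b)" by force
    obtain a' b' where [simp]: "y = (a', b')" by force
    have m: "a \<in> carrier A" "b \<in> carrier B" "a' \<in> carrier A" "b' \<in> carrier B"
      using xy by (auto simp: cG)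
    note st = star[OF oppc[OF w] m(1,4)] star[OF w m(3,2)]
    have "binop E w (f x) (f y) =
        binop E w (i a) (i a') \<otimes>\<^bsub>E\<^esub> binop E w (i a) (s b') \<otimes>\<^bsub>E\<^esub>
        (binop E w (s b) (i a') \<otimes>\<^bsub>E\<^esub> binop E w (s b) (s b'))"
      using m object_binop_left_distrib[OF C E w, of "i a' \<otimes>\<^bsub>E\<^esub> s b'"]
        object_binop_right_distrib[OF C E w, of _ "i a'" "s b'"]
      by (simp add: f_def)
    moreover have "binop E (opp C w) (s b') (i a) = binop E w (i a) (s b')"
      using m object_binop_opp[OF C E w] by simp
    ultimately show ?thesis using m st w
      by (simp add: G_def semidirect_def f_def bincl binclB binclE E.m_assoc)
  qed
  have one: "\<one>\<^bsub>G\<^esub> \<in> carrier G" "f \<one>\<^bsub>G\<^esub> = \<one>\<^bsub>E\<^esub>"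
    by (simp_all add: G_def semidirect_def f_def)
  have wf: "\<forall>(l, r) \<in> identities C. wf_op_term C l \<and> wf_op_term C r"
    using C unfolding groups_with_operations_def by blast
  show "object C G"
    using object_transport[OF wf E bij one(1) mult un bin one(2)] by blast
  show "morphism C G E f"
    using mult un bin bij by (auto simp: morphism_def hom_def bij_betw_def)
qed

theorem derived_actionsI:
  fixes A :: "('a, 'u, 'w) op_group" and B :: "('b, 'u, 'w) op_group"
    and E :: "('e, 'u, 'w) op_group"
  assumes C: "groups_with_operations C"
    and se: "split_extension C A E B i p s"
    and ia: "induced_actions C A E B i s dot star"
  shows "derived_actions C A B dot star"
proof -
  define G where "G = semidirect C A B dot star"
  define f where "f = (\<lambda>(a, b). i a \<otimes>\<^bsub>E\<^esub> s b)"
  have G: "object C G" and bij: "bij_betw f (carrier G) (carrier E)" and mf: "morphism C G E f"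
    using split_extension_semidirect[OF C se ia] by (simp_all add: G_def f_def)
  have A: "object C A" and E: "object C E" and B: "object C B"
    and mi: "morphism C A E i" and mp: "morphism C E B p" and ms: "morphism C B E s"
    and inj_i: "inj_on i (carrier A)" and im_i: "i ` carrier A = kernel E B p"
    and imp: "p ` carrier E = carrier B"
    and ps: "\<And>b. b \<in> carrier B \<Longrightarrow> p (s b) = b"
    using se by (auto simp: split_extension_def)
  interpret G: group G using G by (simp add: object_def)
  interpret A: group A using A by (simp add: object_def)
  interpret B: group B using B by (simp add: object_def)
  interpret E: group E using E by (simp add: object_def)
  interpret i: group_hom A E i by unfold_locales (use mi in \<open>simp add: morphism_def\<close>)
  interpret p: group_hom E B p by unfold_locales (use mp in \<open>simp add: morphism_def\<close>)
  interpret s: group_hom B E s by unfold_locales (use ms in \<open>simp add: morphism_def\<close>)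
  interpret f: group_hom G E f by unfold_locales (use mf in \<open>simp add: morphism_def\<close>)
  have inj: "x = y" if "x \<in> carrier G" "y \<in> carrier G" "f x = f y" for x y
    using bij that by (auto simp: bij_betw_def inj_on_def)
  have cG: "carrier G = carrier A \<times> carrier B" by (simp add: G_def semidirect_def)
  have oneG: "\<one>\<^bsub>G\<^esub> = (\<one>\<^bsub>A\<^esub>, \<one>\<^bsub>B\<^esub>)" by (simp add: G_def semidirect_def)
  let ?i = "\<lambda>a. (a, \<one>\<^bsub>B\<^esub>)" and ?s = "\<lambda>b. (\<one>\<^bsub>A\<^esub>, b)"
  have fi: "f (?i a) = i a" if "a \<in> carrier A" for a using that by (simp add: f_def)
  have fs: "f (?s b) = s b" if "b \<in> carrier B" for b using that by (simp add: f_def)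
  have clA: "unop A \<omega> a \<in> carrier A" if "\<omega> \<in> unary C" "a \<in> carrier A" for \<omega> a
    using A that by (simp add: object_def)
  have clA': "binop A w a a' \<in> carrier A" if "w \<in> binary C" "a \<in> carrier A" "a' \<in> carrier A" for w a a'
    using A that by (simp add: object_def)
  have clB: "unop B \<omega> a \<in> carrier B" if "\<omega> \<in> unary C" "a \<in> carrier B" for \<omega> a
    using B that by (simp add: object_def)
  have clB': "binop B w a a' \<in> carrier B" if "w \<in> binary C" "a \<in> carrier B" "a' \<in> carrier B" for w a a'
    using B that by (simp add: object_def)
  have clG: "unop G \<omega> a \<in> carrier G" if "\<omega> \<in> unary C" "a \<in> carrier G" for \<omega> a
    using G that by (simp add: object_def)
  have clG': "binop G w a a' \<in> carrier G" if "w \<in> binary C" "a \<in> carrier G" "a' \<in> carrier G" for w a a'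
    using G that by (simp add: object_def)
  have ifull: "unop E \<omega> (i a) = i (unop A \<omega> a)" if "\<omega> \<in> unary C" "a \<in> carrier A" for \<omega> a
    using mi that by (simp add: morphism_def)
  have ifull': "binop E w (i a) (i a') = i (binop A w a a')"
    if "w \<in> binary C" "a \<in> carrier A" "a' \<in> carrier A" for w a a'
    using mi that by (simp add: morphism_def)
  have sfull: "unop E \<omega> (s a) = s (unop B \<omega> a)" if "\<omega> \<in> unary C" "a \<in> carrier B" for \<omega> a
    using ms that by (simp add: morphism_def)
  have sfull': "binop E w (s a) (s a') = s (binop B w a a')"
    if "w \<in> binary C" "a \<in> carrier B" "a' \<in> carrier B" for w a a'
    using ms that by (simp add: morphism_def)
  have ffull: "f (unop G \<omega> x) = unop E \<omega> (f x)" if "\<omega> \<in> unary C" "x \<in> carrier G" for \<omega> x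
    using mf that by (simp add: morphism_def)
  have ffull': "f (binop G w x y) = binop E w (f x) (f y)"
    if "w \<in> binary C" "x \<in> carrier G" "y \<in> carrier G" for w x y
    using mf that by (simp add: morphism_def)
  have ic: "?i a \<in> carrier G" if "a \<in> carrier A" for a using that by (simp add: cG)
  have sc: "?s b \<in> carrier G" if "b \<in> carrier B" for b using that by (simp add: cG)
  have mi': "morphism C A G ?i"
    unfolding morphism_def hom_def
    by (auto simp: ic intro!: inj)
       (simp_all add: ic fi ffull ffull' ifull ifull' clA clA' clG clG')
  have ms': "morphism C B G ?s"
    unfolding morphism_def hom_def
    by (auto simp: sc intro!: inj)
       (simp_all add: sc fs ffull ffull' sfull sfull' clB clB' clG clG')
  have mp': "morphism C G B snd"
    unfolding morphism_def hom_def by (auto simp: G_def semidirect_def)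
  have "?i ` carrier A = kernel G B snd" by (auto simp: kernel_def cG)
  moreover have "snd ` carrier G = carrier B" using A.one_closed by (force simp: cG)
  ultimately have "split_extension C A G B ?i snd ?s"
    using A B G mi' ms' mp' by (simp add: split_extension_def inj_on_def)
  moreover have "induced_actions C A G B ?i ?s dot star"
  proof -
    have dot: "dot b a \<in> carrier A \<and> i (dot b a) = s b \<otimes>\<^bsub>E\<^esub> i a \<otimes>\<^bsub>E\<^esub> inv\<^bsub>E\<^esub> s b"
      if "a \<in> carrier A" "b \<in> carrier B" for a b
      using ia that by (simp add: induced_actions_def)
    have star: "star w b a \<in> carrier A \<and> i (star w b a) = binop E w (s b) (i a)"
      if "w \<in> binary C" "a \<in> carrier A" "b \<in> carrier B" for w a b
      using ia that by (simp add: induced_actions_def)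
    have "?i (dot b a) = ?s b \<otimes>\<^bsub>G\<^esub> ?i a \<otimes>\<^bsub>G\<^esub> inv\<^bsub>G\<^esub> ?s b"
      if "a \<in> carrier A" "b \<in> carrier B" for a b
      by (rule inj) (use that dot[OF that] in \<open>simp_all add: ic sc fi fs\<close>)
    moreover have "?i (star w b a) = binop G w (?s b) (?i a)"
      if "w \<in> binary C" "a \<in> carrier A" "b \<in> carrier B" for w a b
      by (rule inj) (use that star[OF that] in \<open>simp_all add: ic sc fi fs ffull' clG'\<close>)
    ultimately show ?thesis using dot star by (simp add: induced_actions_def)
  qed
  ultimately show ?thesis unfolding derived_actions_def by blast
qed

corollary semidirect_object:
  assumes "groups_with_operations C" "derived_actions C A B dot star"
  shows "object C (semidirect C A B dot star)"
  using assms split_extension_semidirect(1) unfolding derived_actions_def by blast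

section \<open>The cat1-group of a crossed module is a cat1-group\<close>

lemma object_binop_one:
  assumes C: "groups_with_operations C" and A: "object C A" and w: "w \<in> binary C"
    and a: "a \<in> carrier A"
  shows "binop A w a \<one>\<^bsub>A\<^esub> = \<one>\<^bsub>A\<^esub>" "binop A w \<one>\<^bsub>A\<^esub> a = \<one>\<^bsub>A\<^esub>"
proof -
  interpret group A using A by (simp add: object_def)
  have cl: "binop A w a \<one>\<^bsub>A\<^esub> \<in> carrier A" "binop A w \<one>\<^bsub>A\<^esub> a \<in> carrier A"
    using A w a by (auto simp: object_def)
  show "binop A w a \<one>\<^bsub>A\<^esub> = \<one>\<^bsub>A\<^esub>"
    using object_binop_right_distrib[OF C A w a one_closed one_closed] cl by simp
  show "binop A w \<one>\<^bsub>A\<^esub> a = \<one>\<^bsub>A\<^esub>"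
    using object_binop_left_distrib[OF C A w a one_closed one_closed] cl by simp
qed

lemma object_unop_one:
  assumes C: "groups_with_operations C" and A: "object C A" and \<omega>: "\<omega> \<in> unary C"
  shows "unop A \<omega> \<one>\<^bsub>A\<^esub> = \<one>\<^bsub>A\<^esub>"
proof -
  interpret group A using A by (simp add: object_def)
  have "unop A \<omega> \<one>\<^bsub>A\<^esub> \<in> carrier A" using A \<omega> by (auto simp: object_def)
  then show ?thesis using object_unop_distrib[OF C A \<omega> one_closed one_closed] by simp
qed

theorem cat1_group_of_crossed:
  fixes X :: "('a, 'b, 'u, 'w) crossed"
  assumes C: "groups_with_operations C" and X: "crossed_module C X"
  shows "cat1_group C (cat1_of_crossed C X)"
proof -
  define A where "A = src X"
  define B where "B = tgt X"
  define \<alpha> where "\<alpha> = bdry X"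
  define dot where "dot = act_dot X"
  define star where "star = act_star X"
  note defs = A_def[symmetric] B_def[symmetric] \<alpha>_def[symmetric] dot_def[symmetric] star_def[symmetric]
  define G where "G = semidirect C A B dot star"
  have A: "object C A" and B: "object C B" and der: "derived_actions C A B dot star"
    and ma: "morphism C A B \<alpha>"
    and cdot: "\<And>a b. a \<in> carrier A \<Longrightarrow> b \<in> carrier B \<Longrightarrow> \<alpha> (dot b a) = b \<otimes>\<^bsub>B\<^esub> \<alpha> a \<otimes>\<^bsub>B\<^esub> inv\<^bsub>B\<^esub> b"
    and peif: "\<And>a a'. a \<in> carrier A \<Longrightarrow> a' \<in> carrier A \<Longrightarrow> dot (\<alpha> a) a' = a \<otimes>\<^bsub>A\<^esub> a' \<otimes>\<^bsub>A\<^esub> inv\<^bsub>A\<^esub> a"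
    and peis: "\<And>w a a'. w \<in> binary C \<Longrightarrow> a \<in> carrier A \<Longrightarrow> a' \<in> carrier A \<Longrightarrow>
       star w (\<alpha> a) a' = binop A w a a'"
    and cstar: "\<And>w a b. w \<in> binary C \<Longrightarrow> a \<in> carrier A \<Longrightarrow> b \<in> carrier B \<Longrightarrow>
       \<alpha> (star w b a) = binop B w b (\<alpha> a)"
    and cstar': "\<And>w a b. w \<in> binary C \<Longrightarrow> a \<in> carrier A \<Longrightarrow> b \<in> carrier B \<Longrightarrow>
       \<alpha> (star (opp C w) b a) = binop B w (\<alpha> a) b"
    using X by (simp_all add: crossed_module_def Let_def defs)
  interpret A: group A using A by (simp add: object_def)
  interpret B: group B using B by (simp add: object_def)
  interpret a: group_hom A B \<alpha> by unfold_locales (use ma in \<open>simp add: morphism_def\<close>)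
  have G: "object C G" unfolding G_def by (rule semidirect_object[OF C der])
  have oppc: "opp C w \<in> binary C" if "w \<in> binary C" for w
    using C that unfolding groups_with_operations_def by blast
  obtain E :: "('a \<times> 'b, 'u, 'w) op_group" and i p s
    where se: "split_extension C A E B i p s" and ia: "induced_actions C A E B i s dot star"
    using der unfolding derived_actions_def by blast
  have E: "object C E" and mi: "morphism C A E i" and ms: "morphism C B E s"
    and inj_i: "inj_on i (carrier A)"
    using se by (auto simp: split_extension_def)
  interpret E: group E using E by (simp add: object_def)
  interpret i: group_hom A E i by unfold_locales (use mi in \<open>simp add: morphism_def\<close>)
  interpret s: group_hom B E s by unfold_locales (use ms in \<open>simp add: morphism_def\<close>)
  have dotc: "dot b a \<in> carrier A" and doti: "i (dot b a) = s b \<otimes>\<^bsub>E\<^esub> i a \<otimes>\<^bsub>E\<^esub> inv\<^bsub>E\<^esub> s b"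
    if "a \<in> carrier A" "b \<in> carrier B" for a b
    using ia that by (auto simp: induced_actions_def)
  have starc: "star w b a \<in> carrier A" and stari: "i (star w b a) = binop E w (s b) (i a)"
    if "w \<in> binary C" "a \<in> carrier A" "b \<in> carrier B" for w a b
    using ia that by (auto simp: induced_actions_def)
  have inj: "x = y" if "x \<in> carrier A" "y \<in> carrier A" "i x = i y" for x y
    using inj_i that by (auto simp: inj_on_def)
  have dot1: "dot b \<one>\<^bsub>A\<^esub> = \<one>\<^bsub>A\<^esub>" if "b \<in> carrier B" for b
    by (rule inj) (use that in \<open>simp_all add: dotc doti\<close>)
  have dot1': "dot \<one>\<^bsub>B\<^esub> a = a" if "a \<in> carrier A" for a
    by (rule inj) (use that in \<open>simp_all add: dotc doti\<close>)
  have star1: "star w b \<one>\<^bsub>A\<^esub> = \<one>\<^bsub>A\<^esub>" if "w \<in> binary C" "b \<in> carrier B" for w b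
    by (rule inj) (use that in \<open>simp_all add: starc stari object_binop_one[OF C E]\<close>)
  have star1': "star w \<one>\<^bsub>B\<^esub> a = \<one>\<^bsub>A\<^esub>" if "w \<in> binary C" "a \<in> carrier A" for w a
    by (rule inj) (use that in \<open>simp_all add: starc stari object_binop_one[OF C E]\<close>)
  have un: "unop A \<omega> a \<in> carrier A" "\<alpha> (unop A \<omega> a) = unop B \<omega> (\<alpha> a)"
    if "\<omega> \<in> unary C" "a \<in> carrier A" for \<omega> a
    using A ma that by (auto simp: object_def morphism_def)
  have bin: "binop A w a a' \<in> carrier A" "\<alpha> (binop A w a a') = binop B w (\<alpha> a) (\<alpha> a')"
    if "w \<in> binary C" "a \<in> carrier A" "a' \<in> carrier A" for w a a'
    using A ma that by (auto simp: object_def morphism_def)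
  have unB: "unop B \<omega> a \<in> carrier B" if "\<omega> \<in> unary C" "a \<in> carrier B" for \<omega> a
    using B that by (auto simp: object_def)
  have binB: "binop B w a a' \<in> carrier B" if "w \<in> binary C" "a \<in> carrier B" "a' \<in> carrier B" for w a a'
    using B that by (auto simp: object_def)
  let ?s = "\<lambda>(a, b). (\<one>\<^bsub>A\<^esub>, b)" and ?t = "\<lambda>(a, b). (\<one>\<^bsub>A\<^esub>, \<alpha> a \<otimes>\<^bsub>B\<^esub> b)"
  note Gs = G_def semidirect_def
  have "morphism C G G ?s"
    by (auto simp: morphism_def hom_def Gs dot1 star1 oppc object_unop_one[OF C A]
        object_binop_one[OF C A])
  moreover have "morphism C G G ?t"
  proof -
    have hom: "?t \<in> hom G G"
    proof (rule homI)
      fix x y assume "x \<in> carrier G" "y \<in> carrier G"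
      then obtain a b a' b' where x: "x = (a, b)" and y: "y = (a', b')"
        and m: "a \<in> carrier A" "b \<in> carrier B" "a' \<in> carrier A" "b' \<in> carrier B"
        by (auto simp: Gs)
      have *: "inv\<^bsub>B\<^esub> b \<otimes>\<^bsub>B\<^esub> (b \<otimes>\<^bsub>B\<^esub> b') = b'" using m by (simp flip: B.m_assoc)
      show "?t (x \<otimes>\<^bsub>G\<^esub> y) = ?t x \<otimes>\<^bsub>G\<^esub> ?t y"
        using m * by (simp add: x y Gs dotc dot1 cdot B.m_assoc)
    qed (auto simp: Gs)
    have "?t (binop G w x y) = binop G w (?t x) (?t y)"
      if w: "w \<in> binary C" and xy: "x \<in> carrier G" "y \<in> carrier G" for w x y
    proof -
      from xy obtain a b a' b' where x: "x = (a, b)" and y: "y = (a', b')"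
        and m: "a \<in> carrier A" "b \<in> carrier B" "a' \<in> carrier A" "b' \<in> carrier B"
        by (auto simp: Gs)
      note oc = oppc[OF w]
      have al: "\<alpha> a \<in> carrier B" "\<alpha> a' \<in> carrier B" "\<alpha> a \<otimes>\<^bsub>B\<^esub> b \<in> carrier B"
        "\<alpha> a' \<otimes>\<^bsub>B\<^esub> b' \<in> carrier B" using m by auto
      have "binop B w (\<alpha> a \<otimes>\<^bsub>B\<^esub> b) (\<alpha> a' \<otimes>\<^bsub>B\<^esub> b') =
        binop B w (\<alpha> a) (\<alpha> a' \<otimes>\<^bsub>B\<^esub> b') \<otimes>\<^bsub>B\<^esub> binop B w b (\<alpha> a' \<otimes>\<^bsub>B\<^esub> b')"
        using object_binop_left_distrib[OF C B w al(4,1) m(2)] .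
      also have "\<dots> = binop B w (\<alpha> a) (\<alpha> a') \<otimes>\<^bsub>B\<^esub> binop B w (\<alpha> a) b' \<otimes>\<^bsub>B\<^esub>
          (binop B w b (\<alpha> a') \<otimes>\<^bsub>B\<^esub> binop B w b b')"
        using object_binop_right_distrib[OF C B w _ al(2) m(4)] al m by simp
      finally show ?thesis using m w oc
        by (simp add: x y Gs starc star1 cstar cstar' bin binB B.m_assoc object_binop_one[OF C A]
            object_binop_opp[OF C B w])
    qed
    moreover have "?t (unop G \<omega> x) = unop G \<omega> (?t x)" if "\<omega> \<in> unary C" "x \<in> carrier G" for \<omega> x
      using that by (auto simp: Gs un object_unop_one[OF C A] object_unop_distrib[OF C B])
    ultimately show ?thesis using hom by (auto simp: morphism_def)
  qed
  moreover have "?s (?t x) = ?t x \<and> ?t (?s x) = ?s x" if "x \<in> carrier G" for x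
    using that by (auto simp: Gs)
  moreover have "x \<otimes>\<^bsub>G\<^esub> y = y \<otimes>\<^bsub>G\<^esub> x \<and> (\<forall>w \<in> binary C. binop G w x y = \<one>\<^bsub>G\<^esub>)"
    if "x \<in> kernel G G ?s" "y \<in> kernel G G ?t" for x y
  proof -
    from that obtain a a' b where x: "x = (a, \<one>\<^bsub>B\<^esub>)" and y: "y = (a', b)"
      and m: "a \<in> carrier A" "a' \<in> carrier A" "b \<in> carrier B" and ab: "\<alpha> a' \<otimes>\<^bsub>B\<^esub> b = \<one>\<^bsub>B\<^esub>"
      by (auto simp: kernel_def Gs)
    have b: "b = \<alpha> (inv\<^bsub>A\<^esub> a')" using ab m B.inv_equality[OF B.inv_comm[OF ab]] by simp
    have 1: "a' \<otimes>\<^bsub>A\<^esub> (inv\<^bsub>A\<^esub> a' \<otimes>\<^bsub>A\<^esub> (a \<otimes>\<^bsub>A\<^esub> a')) = a \<otimes>\<^bsub>A\<^esub> a'"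
      using m by (simp flip: A.m_assoc)
    have "x \<otimes>\<^bsub>G\<^esub> y = y \<otimes>\<^bsub>G\<^esub> x"
      using m 1 peif[of "inv\<^bsub>A\<^esub> a'" a] by (simp add: x y Gs b dot1' A.m_assoc del: a.hom_inv)
    moreover have "binop G w x y = \<one>\<^bsub>G\<^esub>" if w: "w \<in> binary C" for w
    proof -
      have "star (opp C w) b a = binop A w a (inv\<^bsub>A\<^esub> a')"
        using m b peis[OF oppc[OF w], of "inv\<^bsub>A\<^esub> a'" a] object_binop_opp[OF C A w] by simp
      moreover have "binop A w a a' \<otimes>\<^bsub>A\<^esub> binop A w a (inv\<^bsub>A\<^esub> a') = \<one>\<^bsub>A\<^esub>"
        using object_binop_right_distrib[OF C A w m(1,2), of "inv\<^bsub>A\<^esub> a'"] m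
          object_binop_one[OF C A w] by simp
      ultimately show ?thesis using m w
        by (simp add: x y Gs star1' object_binop_one[OF C B])
    qed
    ultimately show ?thesis by blast
  qed
  ultimately have "cat1_group C (G, ?s, ?t)" unfolding cat1_group_def prod.case using G by blast
  then show ?thesis by (simp add: cat1_of_crossed_def defs G_def)
qed

end

theory Submission
  imports Defs
begin

text \<open>
  Write the elements of \<open>G = A \<rtimes> B\<close> as pairs, so that \<open>N = S \<rtimes> T\<close> has the carrier \<open>S \<times> T\<close>.

  Both semidirect products are objects, and the operations of \<open>N\<close> restrict those of \<open>G\<close> because the
  actions of \<open>T\<close> on \<open>S\<close> restrict those of \<open>B\<close> on \<open>A\<close>. An object sitting in this way inside another
  one is a subobject: its inverses satisfy the equation that characterizes inverses in the larger
  group. So \<open>N\<close> is a subobject of \<open>G\<close> (\<open>semidirect_subobject\<close>).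

  For normality it is enough to solve \<open>g + n = n' + g\<close> for \<open>n' \<in> N\<close>, which avoids computing the inverse
  of \<open>g\<close>. With \<open>g = (a, b)\<close>, \<open>n = (x, t)\<close> and \<open>n' = (x', t')\<close> the equation reads
  \<open>a + b\<cdot>x = x' + t'\<cdot>a\<close> and \<open>b + t = t' + b\<close>. Hence \<open>t' = b + t - b\<close>, which lies in \<open>T\<close> by normality
  of \<open>T\<close> in \<open>B\<close>, and \<open>x' = a + b\<cdot>x - t'\<cdot>a = (a + b\<cdot>x - a) - (t'\<cdot>a - a)\<close>. The second bracket is in
  \<open>S\<close> by hypothesis. The first is \<open>\<alpha>(a)\<cdot>(b\<cdot>x)\<close> by the Peiffer identity, hence in \<open>S\<close> since \<open>S\<close> is
  stable under the action of \<open>B\<close> (\<open>normal_subcrossed_commute\<close>).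

  For a further binary operation, the first component of \<open>(a, b) \<star> (x, t)\<close> is \<open>a\<star>x + a\<star>t + b\<star>x\<close>. The
  last two summands lie in \<open>S\<close> by hypothesis, and the first one because it equals \<open>\<alpha>(a)\<star>x\<close>, again
  by a Peiffer identity.
\<close>

text \<open>
  Closure of \<open>M\<close> under the operations comes from \<open>M\<close> being an object. Only inverses need an argument,
  as \<open>inv\<close> is not among the operations assumed to agree: the inverse in \<open>M\<close> is a left inverse in \<open>A\<close>.
\<close>

lemma subobjectI:
  assumes A: "object C A" and M: "object C M" and sub: "carrier M \<subseteq> carrier A"
    and one: "\<one>\<^bsub>M\<^esub> = \<one>\<^bsub>A\<^esub>"
    and mult: "\<And>a b. a \<in> carrier M \<Longrightarrow> b \<in> carrier M \<Longrightarrow> a \<otimes>\<^bsub>M\<^esub> b = a \<otimes>\<^bsub>A\<^esub> b"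
    and un: "\<And>\<omega> a. \<omega> \<in> unary C \<Longrightarrow> a \<in> carrier M \<Longrightarrow> unop M \<omega> a = unop A \<omega> a"
    and bin: "\<And>w a b. w \<in> binary C \<Longrightarrow> a \<in> carrier M \<Longrightarrow> b \<in> carrier M \<Longrightarrow>
      binop M w a b = binop A w a b"
  shows "subobject C M A"
proof -
  interpret A: group A using A by (simp add: object_def)
  interpret M: group M using M by (simp add: object_def)
  have "subgroup (carrier M) A"
  proof
    fix x assume x: "x \<in> carrier M"
    have "inv\<^bsub>M\<^esub> x \<otimes>\<^bsub>A\<^esub> x = \<one>\<^bsub>A\<^esub>" using x mult[of "inv\<^bsub>M\<^esub> x" x] one by simp
    then have "inv\<^bsub>A\<^esub> x = inv\<^bsub>M\<^esub> x" using A.inv_equality x sub by blast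
    then show "inv\<^bsub>A\<^esub> x \<in> carrier M" using x by simp
  next
    fix x y assume "x \<in> carrier M" "y \<in> carrier M"
    then show "x \<otimes>\<^bsub>A\<^esub> y \<in> carrier M" using M.m_closed mult by metis
  next
    show "\<one>\<^bsub>A\<^esub> \<in> carrier M" using M.one_closed one by simp
  qed (rule sub)
  moreover have "unop A \<omega> a \<in> carrier M" if "\<omega> \<in> unary C" "a \<in> carrier M" for \<omega> a
    using M that by (simp add: object_def flip: un)
  moreover have "binop A w a b \<in> carrier M" if "w \<in> binary C" "a \<in> carrier M" "b \<in> carrier M" for w a b
    using M that by (simp add: object_def flip: bin)
  ultimately show ?thesis using A one mult un bin by (simp add: subobject_def)
qed

lemma derived_actions_closed:
  assumes "derived_actions C A B dot star" "b \<in> carrier B" "a \<in> carrier A"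
  shows "dot b a \<in> carrier A" and "w \<in> binary C \<Longrightarrow> star w b a \<in> carrier A"
  using assms unfolding derived_actions_def induced_actions_def by blast+

text \<open>
  The operations of a semidirect product add values of actions using the addition of the first
  factor. The two additions are assumed to agree on \<open>S\<close> only, so the values of the actions of \<open>T\<close> on
  \<open>S\<close>, computed in the larger product, must first be seen to stay in \<open>S\<close>.
\<close>

lemma semidirect_subobject:
  assumes C: "groups_with_operations C"
    and AB: "derived_actions C A B dot star" and ST: "derived_actions C S T dot' star'"
    and S: "subobject C S A" and T: "subobject C T B"
    and dot: "\<And>t x. t \<in> carrier T \<Longrightarrow> x \<in> carrier S \<Longrightarrow> dot' t x = dot t x"
    and star: "\<And>w t x. w \<in> binary C \<Longrightarrow> t \<in> carrier T \<Longrightarrow> x \<in> carrier S \<Longrightarrow> star' w t x = star w t x"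
  shows "subobject C (semidirect C S T dot' star') (semidirect C A B dot star)"
proof (rule subobjectI)
  have obj: "object C S"
    using ST unfolding derived_actions_def split_extension_def by blast
  interpret S: group S using obj by (simp add: object_def)
  have dotc: "dot t x \<in> carrier S" if "t \<in> carrier T" "x \<in> carrier S" for t x
    using derived_actions_closed(1)[OF ST that] dot[OF that] by simp
  have starc: "star w t x \<in> carrier S" if "w \<in> binary C" "t \<in> carrier T" "x \<in> carrier S" for w t x
    using derived_actions_closed(2)[OF ST that(2,3,1)] star[OF that] by simp
  have binc: "binop A w x y \<in> carrier S" if "w \<in> binary C" "x \<in> carrier S" "y \<in> carrier S" for w x y
    using S that by (simp add: subobject_def)
  have oppc: "opp C w \<in> binary C" if "w \<in> binary C" for w
    using C that unfolding groups_with_operations_def by blast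
  have multS: "x \<otimes>\<^bsub>S\<^esub> y = x \<otimes>\<^bsub>A\<^esub> y" if "x \<in> carrier S" "y \<in> carrier S" for x y
    using S that by (simp add: subobject_def)
  have mclS: "x \<otimes>\<^bsub>A\<^esub> y \<in> carrier S" if "x \<in> carrier S" "y \<in> carrier S" for x y
    using S.m_closed[OF that] multS[OF that] by simp
  show "object C (semidirect C S T dot' star')" by (rule semidirect_object[OF C ST])
  show "object C (semidirect C A B dot star)" by (rule semidirect_object[OF C AB])
  let ?N = "semidirect C S T dot' star'" and ?G = "semidirect C A B dot star"
  show "carrier ?N \<subseteq> carrier ?G"
    using S T by (auto simp: semidirect_def subobject_def dest: subgroup.mem_carrier)
  show "\<one>\<^bsub>?N\<^esub> = \<one>\<^bsub>?G\<^esub>" using S T by (simp add: semidirect_def subobject_def)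
  show "n \<otimes>\<^bsub>?N\<^esub> n' = n \<otimes>\<^bsub>?G\<^esub> n'" if "n \<in> carrier ?N" "n' \<in> carrier ?N" for n n'
    using that T by (auto simp: semidirect_def subobject_def dot dotc multS)
  show "unop ?N \<omega> n = unop ?G \<omega> n" if "\<omega> \<in> unary C" "n \<in> carrier ?N" for \<omega> n
    using that S T by (auto simp: semidirect_def subobject_def)
  show "binop ?N w n n' = binop ?G w n n'"
    if "w \<in> binary C" "n \<in> carrier ?N" "n' \<in> carrier ?N" for w n n'
  proof -
    have "binop S w x y = binop A w x y" if "x \<in> carrier S" "y \<in> carrier S" for x y
      using S \<open>w \<in> binary C\<close> that by (simp add: subobject_def)
    moreover have "binop T w x y = binop B w x y" if "x \<in> carrier T" "y \<in> carrier T" for x y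
      using T \<open>w \<in> binary C\<close> that by (simp add: subobject_def)
    ultimately show ?thesis
      using that by (auto simp: semidirect_def star starc oppc binc multS mclS)
  qed
qed

text \<open>
  This form of normality suits semidirect products, where inverses have an unwieldy formula.
\<close>

lemma (in group) normal_of_commute:
  assumes H: "subgroup H G"
    and comm: "\<And>g h. g \<in> carrier G \<Longrightarrow> h \<in> H \<Longrightarrow> \<exists>h'\<in>H. g \<otimes> h = h' \<otimes> g"
  shows "H \<lhd> G"
  unfolding normal_inv_iff
proof (intro conjI ballI)
  fix g h assume g: "g \<in> carrier G" and "h \<in> H"
  then obtain h' where h': "h' \<in> H" "g \<otimes> h = h' \<otimes> g" using comm by blast
  then show "g \<otimes> h \<otimes> inv g \<in> H"
    using g subgroup.mem_carrier[OF H h'(1)] by (simp add: m_assoc)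
qed (rule H)

text \<open>
  The two equations are the components of \<open>(a, b) + (x, t) = (x', t') + (a, b)\<close> in \<open>A \<rtimes> B\<close>, so this
  is the normality of \<open>S \<rtimes> T\<close>. The second one forces \<open>t'\<close>, and then the first one forces \<open>x'\<close>; the
  Peiffer identity is what puts \<open>x'\<close> into \<open>S\<close>.
\<close>

lemma normal_subcrossed_commute:
  assumes XY: "normal_subcrossed_module C Y X"
    and a: "a \<in> carrier (src X)" and b: "b \<in> carrier (tgt X)"
    and x: "x \<in> carrier (src Y)" and t: "t \<in> carrier (tgt Y)"
  shows "\<exists>x'\<in>carrier (src Y). \<exists>t'\<in>carrier (tgt Y).
    a \<otimes>\<^bsub>src X\<^esub> act_dot X b x = x' \<otimes>\<^bsub>src X\<^esub> act_dot X t' a \<and>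
    b \<otimes>\<^bsub>tgt X\<^esub> t = t' \<otimes>\<^bsub>tgt X\<^esub> b"
proof -
  define A B S T \<alpha> dot where "A = src X" "B = tgt X" "S = carrier (src Y)" "T = carrier (tgt Y)"
    "\<alpha> = bdry X" "dot = act_dot X"
  note defs = this
  have X: "crossed_module C X" and S: "subgroup S A" and T: "T \<lhd> B"
    and bS: "\<And>b x. b \<in> carrier B \<Longrightarrow> x \<in> S \<Longrightarrow> dot b x \<in> S"
    and tA: "\<And>t a. t \<in> T \<Longrightarrow> a \<in> carrier A \<Longrightarrow> dot t a \<otimes>\<^bsub>A\<^esub> inv\<^bsub>A\<^esub> a \<in> S"
    using XY unfolding normal_subcrossed_module_def subcrossed_module_def subobject_def op_ideal_def
      Let_def defs by auto
  have A: "group A" and \<alpha>: "\<And>a. a \<in> carrier A \<Longrightarrow> \<alpha> a \<in> carrier B"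
    and peiffer: "\<And>a a'. a \<in> carrier A \<Longrightarrow> a' \<in> carrier A \<Longrightarrow>
      dot (\<alpha> a) a' = a \<otimes>\<^bsub>A\<^esub> a' \<otimes>\<^bsub>A\<^esub> inv\<^bsub>A\<^esub> a"
    using X by (auto simp: crossed_module_def Let_def defs object_def morphism_def hom_def)
  interpret A: group A by (rule A)
  interpret S: subgroup S A by (rule S)
  interpret T: normal T B by (rule T)
  note ab = a[folded defs] b[folded defs] and xt = x[folded defs] t[folded defs]
  \<comment> \<open>Here \<open>k\<close> is the displacement \<open>t'\<cdot>a - a\<close>, and \<open>x'\<close> is \<open>a + b\<cdot>x - t'\<cdot>a\<close>, split as
    \<open>(a + b\<cdot>x - a) - k\<close> with the bracket written as an action of \<open>\<alpha> a\<close>.\<close>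
  define t' where "t' = b \<otimes>\<^bsub>B\<^esub> t \<otimes>\<^bsub>B\<^esub> inv\<^bsub>B\<^esub> b"
  define k where "k = dot t' a \<otimes>\<^bsub>A\<^esub> inv\<^bsub>A\<^esub> a"
  define x' where "x' = dot (\<alpha> a) (dot b x) \<otimes>\<^bsub>A\<^esub> inv\<^bsub>A\<^esub> k"
  have t': "t' \<in> T" unfolding t'_def by (rule T.inv_op_closed2) (use ab xt in auto)
  have k: "k \<in> S" unfolding k_def by (rule tA[OF t' ab(1)])
  have y: "dot b x \<in> S" by (rule bS[OF ab(2) xt(1)])
  have "x' \<in> S" unfolding x'_def using bS[OF \<alpha>[OF ab(1)] y] k by simp
  have "derived_actions C A B dot (act_star X)"
    using X by (simp add: crossed_module_def Let_def defs)
  then have dot_ta: "dot t' a \<in> carrier A"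
    by (rule derived_actions_closed(1)) (use ab t' in auto)
  have "k \<otimes>\<^bsub>A\<^esub> a = dot t' a" using ab dot_ta by (simp add: k_def A.m_assoc)
  then have "inv\<^bsub>A\<^esub> k \<otimes>\<^bsub>A\<^esub> dot t' a = a"
    using ab k S.mem_carrier by (metis A.inv_closed A.m_assoc A.l_inv A.l_one)
  then have "x' \<otimes>\<^bsub>A\<^esub> dot t' a = a \<otimes>\<^bsub>A\<^esub> dot b x"
    using ab k y dot_ta by (simp add: x'_def peiffer A.m_assoc)
  moreover have "t' \<otimes>\<^bsub>B\<^esub> b = b \<otimes>\<^bsub>B\<^esub> t"
    using ab xt by (simp add: t'_def T.m_assoc)
  ultimately show ?thesis using \<open>x' \<in> S\<close> t' unfolding defs by metis
qed

theorem theorem6p7: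
  fixes C :: "('u, 'w) op_theory"
    and X Y :: "('a, 'b, 'u, 'w) crossed"
    and N G :: "('a \<times> 'b, 'u, 'w) op_group"
    and s_N t_N s_G t_G :: "'a \<times> 'b \<Rightarrow> 'a \<times> 'b"
  assumes "groups_with_operations C"
    and "crossed_module C X"
    and "normal_subcrossed_module C Y X"
    and "(N, s_N, t_N) = cat1_of_crossed C Y"
    and "(G, s_G, t_G) = cat1_of_crossed C X"
  shows "op_ideal C N G"
proof -
  define A B S T where "A = src X" "B = tgt X" "S = src Y" "T = tgt Y"
  note defs = this
  note C = assms(1)
  have N: "N = semidirect C S T (act_dot Y) (act_star Y)"
    and G: "G = semidirect C A B (act_dot X) (act_star X)"
    using assms(4,5) by (simp_all add: cat1_of_crossed_def defs)
  have sub: "subcrossed_module C Y X" and T: "op_ideal C T B"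
    and bS: "\<And>w b x. w \<in> binary C \<Longrightarrow> b \<in> carrier B \<Longrightarrow> x \<in> carrier S \<Longrightarrow> act_star X w b x \<in> carrier S"
    and tA: "\<And>w t a. w \<in> binary C \<Longrightarrow> t \<in> carrier T \<Longrightarrow> a \<in> carrier A \<Longrightarrow> act_star X w t a \<in> carrier S"
    using assms(3) by (simp_all add: normal_subcrossed_module_def Let_def defs)
  have S: "subgroup (carrier S) A"
    using sub by (simp add: subcrossed_module_def subobject_def defs)
  have peiffer: "\<And>w a a'. w \<in> binary C \<Longrightarrow> a \<in> carrier A \<Longrightarrow> a' \<in> carrier A \<Longrightarrow>
      act_star X w (bdry X a) a' = binop A w a a'"
    and \<alpha>: "\<And>a. a \<in> carrier A \<Longrightarrow> bdry X a \<in> carrier B"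
    using assms(2) by (auto simp: crossed_module_def Let_def defs morphism_def hom_def)
  have cG: "carrier G = carrier A \<times> carrier B" and cN: "carrier N = carrier S \<times> carrier T"
    by (simp_all add: G N semidirect_def)
  have NG: "subobject C N G"
    unfolding N G
    by (rule semidirect_subobject[OF C])
      (use sub in \<open>auto simp: subcrossed_module_def crossed_module_def Let_def defs\<close>)
  then have "group G" and sg: "subgroup (carrier N) G" by (auto simp: subobject_def object_def)
  have "\<exists>n'\<in>carrier N. g \<otimes>\<^bsub>G\<^esub> n = n' \<otimes>\<^bsub>G\<^esub> g" if "g \<in> carrier G" "n \<in> carrier N" for g n
  proof -
    from that obtain a b x t where [simp]: "g = (a, b)" "n = (x, t)"
      and m: "a \<in> carrier A" "b \<in> carrier B" "x \<in> carrier S" "t \<in> carrier T"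
      by (auto simp: cG cN)
    obtain x' t' where "x' \<in> carrier S" "t' \<in> carrier T"
      "a \<otimes>\<^bsub>A\<^esub> act_dot X b x = x' \<otimes>\<^bsub>A\<^esub> act_dot X t' a" "b \<otimes>\<^bsub>B\<^esub> t = t' \<otimes>\<^bsub>B\<^esub> b"
      using normal_subcrossed_commute[OF assms(3) m[unfolded defs]] unfolding defs by blast
    then have "(x', t') \<in> carrier N" "g \<otimes>\<^bsub>G\<^esub> n = (x', t') \<otimes>\<^bsub>G\<^esub> g"
      by (simp_all add: cN G semidirect_def)
    then show ?thesis by blast
  qed
  then have "carrier N \<lhd> G" by (rule group.normal_of_commute[OF \<open>group G\<close> sg])
  moreover have "binop G w g n \<in> carrier N"
    if w: "w \<in> binary C" and gn: "g \<in> carrier G" "n \<in> carrier N" for w g n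
  proof -
    from gn obtain a b x t where [simp]: "g = (a, b)" "n = (x, t)"
      and m: "a \<in> carrier A" "b \<in> carrier B" "x \<in> carrier S" "t \<in> carrier T"
      by (auto simp: cG cN)
    have opp: "opp C w \<in> binary C" using C w unfolding groups_with_operations_def by blast
    \<comment> \<open>The three summands of the first component: \<open>a \<star> x = \<alpha> a \<star> x\<close>, \<open>a \<star> t = t \<star>\<^sup>o a\<close>, and \<open>b \<star> x\<close>.\<close>
    have "binop A w a x \<in> carrier S"
      using bS[OF w \<alpha>[OF m(1)] m(3)] peiffer[OF w m(1)] subgroup.mem_carrier[OF S m(3)] by simp
    moreover have "act_star X (opp C w) t a \<in> carrier S" by (rule tA[OF opp m(4,1)])
    moreover have "act_star X w b x \<in> carrier S" by (rule bS[OF w m(2,3)])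
    moreover have "binop B w b t \<in> carrier T" using T w m(2,4) by (simp add: op_ideal_def)
    ultimately show ?thesis
      by (simp add: cN G semidirect_def subgroup.m_closed[OF S])
  qed
  ultimately show ?thesis using NG unfolding op_ideal_def by blast
qed

end
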